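(* For every $0<\alpha<1$, there are sets $S_N\subseteq\mathbb Z_N$ such that $$|S_N|\asymp N^\alpha,\qquad |S_N+S_N|\leq6|S_N|,\qquad \operatorname{FR}(1_{S_N})\asymp N^{\frac{1}{2}}.$$ In particular, $E(S_N)\asymp|S_N|^3$ and $\kappa(\{1_{S_N}\})=0$.
   Context: $N$ ranges over the integers $N\ge2$ and $\mathbb Z_N=\mathbb Z/N\mathbb Z$. For $f:\mathbb Z_N\to\mathbb C$ the unitary Fourier transform is $\widehat f(\xi)=N^{-1/2}\sum_{x\in\mathbb Z_N}f(x)e^{-2\pi i x\xi/N}$. Norms use counting measure: $\|f\|_r=(\sum_x|f(x)|^r)^{1/r}$. $1_S$ is the indicator of $S$. For $f\neq0$, $\operatorname{FR}(f)=\|\widehat f\|_1/\|\widehat f\|_2$, $\kappa_N(f)=\log\bigl(N^{1/2}/\operatorname{FR}(f)\bigr)/\log N$, and $\kappa(\{f_N\})=\liminf_{N\to\infty}\kappa_N(f_N)$. $E(S)=\#\{(x_1,x_2,x_3,x_4)\in S^4:x_1+x_2=x_3+x_4\}$ and $S+S=\{x+y:x,y\in S\}$. $A\asymp B$ means $cB\le A\le CB$ with positive constants $c,C$ independent of $N$ (possibly depending on $\alpha$). *)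

theory Defs
  imports
    Complex_Main
    "HOL-Number_Theory.Residues"
    "HOL-Library.Extended_Real"
    "HOL-Library.Indicator_Function"
begin

text \<open>
  The group of residues modulo \<open>N\<close> is the library ring \<^const>\<open>residue_ring\<close>, whose carrier is the
  set of integers \<open>{0..N - 1}\<close>. A function on it is a function on \<^typ>\<open>int\<close> of which only the values
  on the carrier are used.
\<close>

abbreviation ZN :: "nat \<Rightarrow> int ring" where
  "ZN N \<equiv> residue_ring (int N)"

definition fourier :: "nat \<Rightarrow> (int \<Rightarrow> complex) \<Rightarrow> int \<Rightarrow> complex" where
  "fourier N f \<xi> = of_real (real N powr (-1/2)) *
     (\<Sum>x\<in>carrier (ZN N). f x * exp (- 2 * of_real pi * \<i> * of_int (x * \<xi>) / of_nat N))"

definition lr_norm :: "nat \<Rightarrow> real \<Rightarrow> (int \<Rightarrow> complex) \<Rightarrow> real" where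
  "lr_norm N r f = (\<Sum>x\<in>carrier (ZN N). cmod (f x) powr r) powr (1 / r)"

text \<open>
  The ratio \<open>FR\<close> and the exponents built from it are meant for functions that do not vanish
  identically on the carrier; otherwise they take junk values.
\<close>

definition FR :: "nat \<Rightarrow> (int \<Rightarrow> complex) \<Rightarrow> real" where
  "FR N f = lr_norm N 1 (fourier N f) / lr_norm N 2 (fourier N f)"

definition kappa_at :: "nat \<Rightarrow> (int \<Rightarrow> complex) \<Rightarrow> real" where
  "kappa_at N f = ln (real N powr (1/2) / FR N f) / ln (real N)"

definition kappa :: "(nat \<Rightarrow> int \<Rightarrow> complex) \<Rightarrow> ereal" where
  "kappa f = liminf (\<lambda>N. ereal (kappa_at N (f N)))"

definition sumset :: "nat \<Rightarrow> int set \<Rightarrow> int set" where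
  "sumset N S = {x \<oplus>\<^bsub>ZN N\<^esub> y | x y. x \<in> S \<and> y \<in> S}"

definition energy :: "nat \<Rightarrow> int set \<Rightarrow> nat" where
  "energy N S = card {(x1, x2, x3, x4). x1 \<in> S \<and> x2 \<in> S \<and> x3 \<in> S \<and> x4 \<in> S \<and>
     x1 \<oplus>\<^bsub>ZN N\<^esub> x2 = x3 \<oplus>\<^bsub>ZN N\<^esub> x4}"

text \<open>
  The constants are uniform over the whole range \<open>N \<ge> 2\<close>, so this is not the eventual notion
  of \<open>\<Theta>\<close> from the Landau symbols.
\<close>

definition comparable :: "(nat \<Rightarrow> real) \<Rightarrow> (nat \<Rightarrow> real) \<Rightarrow> bool" where
  "comparable A B \<longleftrightarrow>
     (\<exists>c C. 0 < c \<and> 0 < C \<and> (\<forall>N\<ge>2. c * B N \<le> A N \<and> A N \<le> C * B N))"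

end

theory Submission
  imports Defs "HOL-Analysis.Convex"
begin

text \<open>
  Let \<open>r\<close> be a Rudin--Shapiro sequence of signs on an interval of \<open>L = 2 ^ k \<asymp> N powr \<alpha>\<close> residues,
  and let \<open>S\<close> be the set where \<open>r = 1\<close>. It has at least \<open>L / 2\<close> elements and lies in an interval
  of length \<open>L\<close>, so its doubling is at most 4 and its energy is of order \<open>|S| ^ 3\<close>. The transform of
  \<open>r\<close> is at most \<open>sqrt (2 * L / N)\<close> everywhere, so pairing the transforms of \<open>1\<^sub>S\<close> and \<open>r\<close> by
  Parseval bounds the 1-norm of the transform of \<open>1\<^sub>S\<close> below by \<open>|S| * sqrt (N / (2 * L))\<close>. Its
  2-norm is \<open>sqrt |S|\<close>, so \<open>FR\<close> is at least \<open>sqrt N / 2\<close>; the upper bound \<open>sqrt N\<close> is Cauchy--Schwarz.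
\<close>

section \<open>The Fourier transform on residues\<close>

lemma carrier_ZN: "carrier (ZN N) = {0..<int N}"
  by (auto simp: residue_ring_def)

lemma add_ZN: "x \<oplus>\<^bsub>ZN N\<^esub> y = (x + y) mod int N"
  by (simp add: residue_ring_def)

text \<open>With the phase written as a multiple of \<open>x\<close>, the transform is a
  trigonometric polynomial at the real point \<open>- 2 * pi * \<xi> / N\<close>, which is how it
  meets \<open>rudin_shapiro_poly\<close>.\<close>

lemma fourier_eq_cis:
  "fourier N f \<xi> = of_real (1 / sqrt (real N)) *
     (\<Sum>x\<in>{0..<int N}. f x * cis (- 2 * pi * of_int \<xi> / real N * of_int x))"
proof -
  have "exp (- 2 * of_real pi * \<i> * of_int (x * \<xi>) / of_nat N)
      = cis (- 2 * pi * of_int \<xi> / real N * of_int x)" for x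
    by (simp add: cis_conv_exp mult_ac)
  moreover have "real N powr (- 1 / 2) = 1 / sqrt (real N)"
    by (simp add: powr_minus_divide powr_half_sqrt)
  ultimately show ?thesis
    by (simp add: fourier_def carrier_ZN)
qed

text \<open>Orthogonality of characters. Off the diagonal this is a geometric sum whose ratio is an
  \<open>N\<close>-th root of unity; the ratio is 1 only if \<open>N\<close> divides
  \<open>y - x\<close>, which \<open>\<bar>y - x\<bar> < N\<close> excludes.\<close>

lemma sum_characters:
  assumes "x \<in> {0..<int N}" "y \<in> {0..<int N}"
  shows "(\<Sum>\<xi>\<in>{0..<int N}. cis (2 * pi * of_int (y - x) / real N * of_int \<xi>))
    = (if x = y then of_nat N else 0)"
proof (cases "x = y")
  case False
  from assms have N: "N > 0" by auto
  define t where "t = 2 * pi * of_int (y - x) / real N"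
  have "cis t \<noteq> 1"
  proof
    assume "cis t = 1"
    then have "cos t = 1" by (metis cis.sel(1) one_complex.sel(1))
    then obtain n :: int where "t = of_int n * 2 * pi"
      by (auto simp: cos_one_2pi_int)
    then have "(2 * pi) * real_of_int (y - x) = (2 * pi) * of_int (n * int N)"
      using N by (simp add: t_def field_simps)
    then have "real_of_int (y - x) = of_int (n * int N)"
      unfolding mult_cancel_left by simp
    then have "y - x = n * int N" by linarith
    then have "int N dvd y - x" by simp
    moreover have "\<bar>y - x\<bar> < int N" using assms by auto
    ultimately show False
      using False zdvd_imp_le[of "int N" "\<bar>y - x\<bar>"] by auto
  qed
  moreover have "cis t ^ N = 1"
  proof -
    have "real N * t = 2 * pi * of_int (y - x)" using N by (simp add: t_def)
    then show ?thesis by (metis DeMoivre Ints_of_int cis_multiple_2pi)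
  qed
  moreover have "(\<Sum>\<xi>\<in>{0..<int N}. cis (t * of_int \<xi>)) = (\<Sum>n<N. cis t ^ n)"
    by (rule sum.reindex_bij_witness[of _ int nat]) (auto simp: DeMoivre mult.commute)
  ultimately show ?thesis
    unfolding t_def[symmetric] using False by (simp add: geometric_sum)
qed simp

text \<open>Expanding both transforms and moving the frequency sum innermost leaves, by
  orthogonality of characters, only the diagonal \<open>x = y\<close>.\<close>

lemma parseval:
  assumes "N > 0"
  shows "(\<Sum>\<xi>\<in>{0..<int N}. fourier N f \<xi> * cnj (fourier N g \<xi>))
    = (\<Sum>x\<in>{0..<int N}. f x * cnj (g x))"
proof -
  let ?A = "{0..<int N}"
  have "fourier N f \<xi> * cnj (fourier N g \<xi>) = (\<Sum>x\<in>?A. \<Sum>y\<in>?A.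
      f x * cnj (g y) / of_nat N * cis (2 * pi * of_int (y - x) / real N * of_int \<xi>))" for \<xi>
  proof -
    \<comment> \<open>The two unitary normalising factors combine to \<open>1 / N\<close>.\<close>
    have "of_real (1 / sqrt (real N)) * of_real (1 / sqrt (real N)) = (1 / of_nat N :: complex)"
      by (simp flip: of_real_mult)
    from arg_cong[OF this, of "\<lambda>u. u * (_ * _)"]
    have "of_real (1 / sqrt (real N)) * a * (of_real (1 / sqrt (real N)) * b) = 1 / of_nat N * (a * b)"
      for a b :: complex
      by (simp only: mult_ac)
    then have "fourier N f \<xi> * cnj (fourier N g \<xi>) = 1 / of_nat N *
       ((\<Sum>x\<in>?A. f x * cis (- 2 * pi * of_int \<xi> / real N * of_int x)) *
        cnj (\<Sum>y\<in>?A. g y * cis (- 2 * pi * of_int \<xi> / real N * of_int y)))"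
      unfolding fourier_eq_cis complex_cnj_mult complex_cnj_complex_of_real .
    also have "\<dots> = (\<Sum>x\<in>?A. \<Sum>y\<in>?A. 1 / of_nat N *
       ((f x * cis (- 2 * pi * of_int \<xi> / real N * of_int x)) *
        (cnj (g y) * cis (- (- 2 * pi * of_int \<xi> / real N * of_int y)))))"
      by (simp only: cnj_sum complex_cnj_mult cis_cnj sum_product) (simp only: sum_distrib_left)
    also have "\<dots> = (\<Sum>x\<in>?A. \<Sum>y\<in>?A.
      f x * cnj (g y) / of_nat N * cis (2 * pi * of_int (y - x) / real N * of_int \<xi>))"
    proof (intro sum.cong refl)
      fix x y :: int
      have "cis (- 2 * pi * of_int \<xi> / real N * of_int x) * cis (- (- 2 * pi * of_int \<xi> / real N * of_int y))
        = cis (2 * pi * of_int (y - x) / real N * of_int \<xi>)"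
        unfolding cis_mult by (rule arg_cong[of _ _ cis]) (simp add: algebra_simps diff_divide_distrib)
      then show "1 / of_nat N *
       ((f x * cis (- 2 * pi * of_int \<xi> / real N * of_int x)) *
        (cnj (g y) * cis (- (- 2 * pi * of_int \<xi> / real N * of_int y)))) =
        f x * cnj (g y) / of_nat N * cis (2 * pi * of_int (y - x) / real N * of_int \<xi>)"
        by (simp only: flip: \<open>cis _ * cis _ = _\<close>) (simp only: divide_inverse mult_ac mult_1_left)
    qed
    finally show ?thesis .
  qed
  then have "(\<Sum>\<xi>\<in>?A. fourier N f \<xi> * cnj (fourier N g \<xi>)) = (\<Sum>\<xi>\<in>?A. \<Sum>x\<in>?A. \<Sum>y\<in>?A.
      f x * cnj (g y) / of_nat N * cis (2 * pi * of_int (y - x) / real N * of_int \<xi>))"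
    by simp
  also have "\<dots> = (\<Sum>x\<in>?A. \<Sum>\<xi>\<in>?A. \<Sum>y\<in>?A.
      f x * cnj (g y) / of_nat N * cis (2 * pi * of_int (y - x) / real N * of_int \<xi>))"
    by (rule sum.swap)
  also have "\<dots> = (\<Sum>x\<in>?A. \<Sum>y\<in>?A. \<Sum>\<xi>\<in>?A.
      f x * cnj (g y) / of_nat N * cis (2 * pi * of_int (y - x) / real N * of_int \<xi>))"
    by (intro sum.cong refl sum.swap)
  also have "\<dots> = (\<Sum>x\<in>?A. \<Sum>y\<in>?A. f x * cnj (g y) / of_nat N * (if x = y then of_nat N else 0))"
    by (intro sum.cong refl) (simp only: sum_distrib_left[symmetric] sum_characters)
  also have "\<dots> = (\<Sum>x\<in>?A. \<Sum>y\<in>?A. if x = y then f x * cnj (g x) else 0)"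
    using assms by (intro sum.cong refl) auto
  also have "\<dots> = (\<Sum>x\<in>?A. f x * cnj (g x))"
    by (intro sum.cong refl) simp
  finally show ?thesis .
qed

section \<open>Norms of the transform and the ratio \<open>FR\<close>\<close>

lemma lr_norm_1: "lr_norm N 1 f = (\<Sum>x\<in>{0..<int N}. cmod (f x))"
  by (simp add: lr_norm_def carrier_ZN sum_nonneg)

lemma lr_norm_2: "lr_norm N 2 f = sqrt (\<Sum>x\<in>{0..<int N}. (cmod (f x))\<^sup>2)"
  by (simp add: lr_norm_def carrier_ZN sum_nonneg powr_half_sqrt)

lemma lr_norm_2_fourier:
  assumes "N > 0"
  shows "lr_norm N 2 (fourier N f) = lr_norm N 2 f"
proof -
  have "complex_of_real (\<Sum>x\<in>{0..<int N}. (cmod (fourier N f x))\<^sup>2)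
      = of_real (\<Sum>x\<in>{0..<int N}. (cmod (f x))\<^sup>2)"
    using parseval[OF assms, of f f] unfolding complex_norm_square[symmetric] of_real_sum .
  then show ?thesis
    unfolding lr_norm_2 of_real_eq_iff by simp
qed

lemma lr_norm_2_indicator:
  assumes "S \<subseteq> {0..<int N}"
  shows "lr_norm N 2 (indicator S) = sqrt (card S)"
proof -
  have "(\<Sum>x\<in>{0..<int N}. (cmod (indicator S x))\<^sup>2) = (\<Sum>x\<in>S. 1)"
    using assms by (intro sum.mono_neutral_cong_right) auto
  then show ?thesis
    by (simp add: lr_norm_2)
qed

text \<open>Cauchy--Schwarz against the constant 1 over the \<open>N\<close> frequencies.\<close>

lemma FR_le_sqrt: "FR N f \<le> sqrt (real N)"
proof -
  let ?F = "\<lambda>\<xi>. cmod (fourier N f \<xi>)"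
  have "(\<Sum>\<xi>\<in>{0..<int N}. ?F \<xi>)\<^sup>2 \<le> (\<Sum>\<xi>\<in>{0..<int N}. (?F \<xi>)\<^sup>2) * real N"
    using sum_squared_le_sum_of_squares[of ?F "{0..<int N}"] by simp
  then have "lr_norm N 1 (fourier N f) \<le> lr_norm N 2 (fourier N f) * sqrt (real N)"
    by (simp add: lr_norm_1 lr_norm_2 real_le_rsqrt flip: real_sqrt_mult)
  moreover have "lr_norm N 2 (fourier N f) \<ge> 0"
    by (simp add: lr_norm_2 sum_nonneg)
  \<comment> \<open>If the 2-norm vanishes, \<open>FR\<close> is a quotient by zero, hence
    0.\<close>
  ultimately show ?thesis
    by (cases "lr_norm N 2 (fourier N f) = 0") (simp_all add: FR_def field_simps)
qed

text \<open>Duality of the 1-norm and the sup norm on the frequency side: a test function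
  \<open>g\<close> with small transform that correlates with \<open>f\<close> forces the transform
  of \<open>f\<close> to have a large 1-norm.\<close>

lemma pairing_le_lr_norm_1_fourier:
  assumes "N > 0" and bound: "\<And>\<xi>. cmod (fourier N g \<xi>) \<le> M"
  shows "cmod (\<Sum>x\<in>{0..<int N}. f x * cnj (g x)) \<le> M * lr_norm N 1 (fourier N f)"
proof -
  have "cmod (\<Sum>x\<in>{0..<int N}. f x * cnj (g x))
      \<le> (\<Sum>\<xi>\<in>{0..<int N}. cmod (fourier N f \<xi> * cnj (fourier N g \<xi>)))"
    unfolding parseval[OF assms(1), of f g, symmetric] by (rule norm_sum)
  also have "\<dots> \<le> (\<Sum>\<xi>\<in>{0..<int N}. M * cmod (fourier N f \<xi>))"
    by (intro sum_mono) (simp add: norm_mult bound mult.commute[of M] mult_left_mono)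
  finally show ?thesis
    by (simp add: lr_norm_1 sum_distrib_left)
qed

section \<open>Rudin--Shapiro signs\<close>

text \<open>
  \<open>rudin_shapiro 1 k\<close> and \<open>rudin_shapiro (- 1) k\<close> are the coefficient sequences of the two
  Rudin--Shapiro polynomials of length \<open>2 ^ k\<close>.
\<close>

fun rudin_shapiro :: "int \<Rightarrow> nat \<Rightarrow> int \<Rightarrow> int" where
  "rudin_shapiro s 0 x = 1"
| "rudin_shapiro s (Suc k) x =
     (if x < 2 ^ k then rudin_shapiro 1 k x else s * rudin_shapiro (- 1) k (x - 2 ^ k))"

lemma rudin_shapiro_cases:
  "s \<in> {1, - 1} \<Longrightarrow> rudin_shapiro s k x \<in> {1, - 1}"
proof (induction k arbitrary: s x)
  case (Suc k)
  from Suc.IH[of 1 x] Suc.IH[of "- 1" "x - 2 ^ k"] Suc.prems show ?case by auto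
qed simp

text \<open>The polynomial evaluated at \<open>cis t\<close>. A real \<open>t\<close> keeps
  \<open>N\<close> out of the recursion in \<open>k\<close>.\<close>

definition rudin_shapiro_poly :: "int \<Rightarrow> nat \<Rightarrow> real \<Rightarrow> complex" where
  "rudin_shapiro_poly s k t =
     (\<Sum>x\<in>{0..<2 ^ k}. of_int (rudin_shapiro s k x) * cis (t * of_int x))"

lemma rudin_shapiro_poly_0 [simp]: "rudin_shapiro_poly s 0 t = 1"
proof -
  have "{0..<1::int} = {0}" by auto
  then show ?thesis by (simp add: rudin_shapiro_poly_def)
qed

text \<open>The second half of the sign sequence is a copy of the other sequence shifted by
  \<open>2 ^ k\<close>, and the shift becomes the factor \<open>cis (t * 2 ^ k)\<close>.\<close>

lemma rudin_shapiro_poly_Suc: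
  "rudin_shapiro_poly s (Suc k) t
    = rudin_shapiro_poly 1 k t + of_int s * cis (t * 2 ^ k) * rudin_shapiro_poly (- 1) k t"
proof -
  let ?f = "\<lambda>x. of_int (rudin_shapiro s (Suc k) x) * cis (t * of_int x)"
  have split: "{0..<2 ^ Suc k} = {0..<2 ^ k} \<union> {2 ^ k..<2 ^ Suc k :: int}" by auto
  have "sum ?f {0..<2 ^ Suc k} = sum ?f {0..<2 ^ k} + sum ?f {2 ^ k..<2 ^ Suc k}"
    unfolding split by (rule sum.union_disjoint) auto
  moreover have "sum ?f {0..<2 ^ k} = rudin_shapiro_poly 1 k t"
    by (simp add: rudin_shapiro_poly_def)
  moreover have "sum ?f {2 ^ k..<2 ^ Suc k} = (\<Sum>x\<in>{0..<2 ^ k}.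
      of_int s * cis (t * 2 ^ k) * (of_int (rudin_shapiro (- 1) k x) * cis (t * of_int x)))"
    by (rule sum.reindex_bij_witness[of _ "\<lambda>x. x + 2 ^ k" "\<lambda>x. x - 2 ^ k"])
      (auto simp: cis_mult algebra_simps)
  ultimately show ?thesis
    by (simp only: rudin_shapiro_poly_def sum_distrib_left)
qed

text \<open>The recursion replaces the pair by \<open>a + b\<close> and \<open>a - b\<close>, where
  \<open>b\<close> is the second polynomial times a unimodular factor; by the parallelogram law each
  step doubles the sum of squares.\<close>

lemma rudin_shapiro_poly_norm_sum:
  "(cmod (rudin_shapiro_poly 1 k t))\<^sup>2 + (cmod (rudin_shapiro_poly (- 1) k t))\<^sup>2 = 2 ^ Suc k"
proof (induction k)
  case (Suc k)
  have parallelogram: "(cmod (a + b))\<^sup>2 + (cmod (a - b))\<^sup>2 = 2 * ((cmod a)\<^sup>2 + (cmod b)\<^sup>2)" for a b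
    unfolding cmod_power2 by (simp add: power2_eq_square algebra_simps)
  show ?case
    using Suc parallelogram[of "rudin_shapiro_poly 1 k t"
        "cis (t * 2 ^ k) * rudin_shapiro_poly (- 1) k t"]
    by (simp add: rudin_shapiro_poly_Suc norm_mult)
qed simp

lemma rudin_shapiro_poly_norm_le: "cmod (rudin_shapiro_poly 1 k t) \<le> sqrt (2 * 2 ^ k)"
proof (rule real_le_rsqrt)
  show "(cmod (rudin_shapiro_poly 1 k t))\<^sup>2 \<le> 2 * 2 ^ k"
    using rudin_shapiro_poly_norm_sum[of k t]
      zero_le_power2[of "cmod (rudin_shapiro_poly (- 1) k t)"]
    unfolding power_Suc by linarith
qed

text \<open>The sum of the signs is the polynomial at \<open>t = 0\<close>, so it obeys the same
  recursion. This is what makes +1 occur at least half of the time.\<close>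

lemma rudin_shapiro_sum_nonneg: "(\<Sum>x\<in>{0..<2 ^ k}. rudin_shapiro 1 k x) \<ge> 0"
proof -
  define p where "p s k = (\<Sum>x\<in>{0..<2 ^ k}. rudin_shapiro s k x)" for s k
  have p_poly: "rudin_shapiro_poly s k 0 = of_int (p s k)" for s k
    by (simp add: rudin_shapiro_poly_def p_def)
  have Suc_p: "p s (Suc k) = p 1 k + s * p (- 1) k" for s k
  proof -
    have "complex_of_int (p s (Suc k)) = of_int (p 1 k + s * p (- 1) k)"
      using rudin_shapiro_poly_Suc[of s k 0] by (simp add: p_poly)
    then show ?thesis by (simp only: of_int_eq_iff)
  qed
  have p_0: "p s 0 = 1" for s
    using p_poly[of s 0] by simp
  \<comment> \<open>Nonnegativity alone is not inductive, since \<open>p (- 1)\<close> becomes a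
    difference; ordering the two sums makes it so.\<close>
  have "0 \<le> p (- 1) k \<and> p (- 1) k \<le> p 1 k"
    by (induction k) (auto simp: Suc_p p_0)
  then show ?thesis by (simp add: p_def)
qed

section \<open>The set of positive signs\<close>

definition rs_set :: "nat \<Rightarrow> int set" where
  "rs_set k = {x \<in> {0..<2 ^ k}. rudin_shapiro 1 k x = 1}"

lemma rs_set_subset: "rs_set k \<subseteq> {0..<2 ^ k}"
  by (auto simp: rs_set_def)

lemma card_rs_set_le: "card (rs_set k) \<le> 2 ^ k"
  using card_mono[OF _ rs_set_subset, of k] by (simp add: nat_power_eq)

text \<open>On the interval the signs equal twice the indicator of the set minus 1, and their sum is
  nonnegative.\<close>

lemma card_rs_set_ge: "2 ^ k \<le> 2 * card (rs_set k)"
proof -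
  have "rudin_shapiro 1 k x = 2 * of_bool (x \<in> rs_set k) - 1" if "x \<in> {0..<2 ^ k}" for x
    using rudin_shapiro_cases[of 1 k x] that by (auto simp: rs_set_def)
  then have "(\<Sum>x\<in>{0..<2 ^ k}. rudin_shapiro 1 k x)
      = (\<Sum>x\<in>{0..<2 ^ k}. 2 * of_bool (x \<in> rs_set k) - 1)"
    by (intro sum.cong refl)
  also have "\<dots> = 2 * int (card ({0..<2 ^ k} \<inter> rs_set k)) - 2 ^ k"
    by (simp add: sum_subtractf flip: sum_distrib_left)
  also have "{0..<2 ^ k} \<inter> rs_set k = rs_set k"
    using rs_set_subset by blast
  finally have "int (2 ^ k) \<le> int (2 * card (rs_set k))"
    using rudin_shapiro_sum_nonneg[of k] by simp
  then show ?thesis by (simp only: of_nat_le_iff)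
qed

lemma FR_rs_set_ge:
  assumes "2 ^ k \<le> N"
  shows "sqrt (real N) / 2 \<le> FR N (indicator (rs_set k))"
proof -
  let ?S = "rs_set k"
  let ?L = "2 ^ k :: real"
  let ?c = "real (card ?S)"
  \<comment> \<open>The test function: the signs extended by zero to the residues. Since
    \<open>2 ^ k \<le> N\<close>, its transform is a scaled value of the polynomial.\<close>
  define g :: "int \<Rightarrow> complex"
    where "g x = (if x \<in> {0..<2 ^ k} then of_int (rudin_shapiro 1 k x) else 0)" for x
  have N: "N > 0" using less_le_trans[OF _ assms] by simp
  have "int (2 ^ k) \<le> int N" using assms by (simp only: of_nat_le_iff)
  then have sub: "{0..<2 ^ k} \<subseteq> {0..<int N}" by auto
  have c: "?L \<le> 2 * ?c"
    using card_rs_set_ge[of k] by (simp flip: of_nat_le_iff[where 'a = real])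
  moreover have "?L > 0" by simp
  ultimately have "?c > 0" by linarith
  have "fourier N g \<xi> = of_real (1 / sqrt (real N)) * rudin_shapiro_poly 1 k (- 2 * pi * of_int \<xi> / real N)" for \<xi>
    unfolding fourier_eq_cis rudin_shapiro_poly_def
    by (intro arg_cong[of _ _ "(*) _"] sum.mono_neutral_cong_right sub) (auto simp: g_def)
  then have "cmod (fourier N g \<xi>) \<le> sqrt (2 * ?L) / sqrt (real N)" for \<xi>
    using rudin_shapiro_poly_norm_le N by (simp add: norm_mult norm_divide divide_right_mono)
  from pairing_le_lr_norm_1_fourier[OF N this, of "indicator ?S"]
  have "cmod (\<Sum>x\<in>{0..<int N}. indicator ?S x * cnj (g x))
      \<le> sqrt (2 * ?L) / sqrt (real N) * lr_norm N 1 (fourier N (indicator ?S))" .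
  \<comment> \<open>The signs are 1 on the set, so nothing cancels in the pairing.\<close>
  moreover have "(\<Sum>x\<in>{0..<int N}. indicator ?S x * cnj (g x)) = (\<Sum>x\<in>?S. 1)"
  proof (intro sum.mono_neutral_cong_right)
    show "?S \<subseteq> {0..<int N}" using sub rs_set_subset[of k] by blast
  qed (auto simp: g_def rs_set_def)
  ultimately have "?c * sqrt (real N) \<le> sqrt (2 * ?L) * lr_norm N 1 (fourier N (indicator ?S))"
    using N by (simp add: field_simps)
  moreover have "lr_norm N 1 (fourier N (indicator ?S)) = FR N (indicator ?S) * sqrt ?c"
    using \<open>?c > 0\<close> N lr_norm_2_indicator[OF order_trans[OF rs_set_subset sub]]
    by (simp add: FR_def lr_norm_2_fourier)
  ultimately have le: "?c * sqrt (real N) \<le> sqrt (2 * ?L * ?c) * FR N (indicator ?S)"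
    by (simp add: real_sqrt_mult mult_ac)
  have FR0: "FR N (indicator ?S) \<ge> 0"
    by (simp add: FR_def lr_norm_1 lr_norm_2 sum_nonneg)
  \<comment> \<open>At least half of the signs are positive, so \<open>2 * ?L * ?c\<close> is at
    most \<open>4 * ?c * ?c\<close>; this is the source of the factor 1/2.\<close>
  have "sqrt (2 * ?L * ?c) \<le> 2 * ?c"
    using c \<open>?c > 0\<close> by (intro real_le_lsqrt) (auto simp: power2_eq_square)
  then have "?c * sqrt (real N) \<le> 2 * ?c * FR N (indicator ?S)"
    using le FR0 mult_right_mono order_trans by blast
  then show ?thesis
    using \<open>?c > 0\<close> by simp
qed

section \<open>Sumsets and energy\<close>

lemma finite_sumset: "finite S \<Longrightarrow> finite (sumset N S)"
  by (rule finite_subset[of _ "(\<lambda>(x, y). x \<oplus>\<^bsub>ZN N\<^esub> y) ` (S \<times> S)"]) (auto simp: sumset_def)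

text \<open>Before reduction the sums lie in an interval of length \<open>2 * L\<close>, and
  reduction modulo \<open>N\<close> does not increase the number of values.\<close>

lemma card_sumset_interval_le:
  assumes "S \<subseteq> {0..<int L}"
  shows "card (sumset N S) \<le> 2 * L"
proof -
  have "sumset N S \<subseteq> (\<lambda>z. z mod int N) ` {0..<int (2 * L)}"
  proof
    fix z assume "z \<in> sumset N S"
    then obtain x y where "x \<in> S" "y \<in> S" "z = (x + y) mod int N"
      by (auto simp: sumset_def add_ZN)
    moreover from \<open>x \<in> S\<close> \<open>y \<in> S\<close> have "x \<in> {0..<int L}" "y \<in> {0..<int L}"
      using assms by blast+
    then have "x + y \<in> {0..<int (2 * L)}" by auto
    ultimately show "z \<in> (\<lambda>z. z mod int N) ` {0..<int (2 * L)}"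
      by blast
  qed
  then have "card (sumset N S) \<le> card ((\<lambda>z. z mod int N) ` {0..<int (2 * L)})"
    by (intro card_mono) auto
  also have "\<dots> \<le> card {0..<int (2 * L)}" by (rule card_image_le) simp
  finally show ?thesis by simp
qed

text \<open>Three entries of an additive quadruple determine the fourth, because elements of
  \<open>S\<close> are reduced residues.\<close>

lemma energy_le:
  assumes "S \<subseteq> {0..<int N}"
  shows "energy N S \<le> card S ^ 3"
proof -
  let ?Q = "{(x1, x2, x3, x4). x1 \<in> S \<and> x2 \<in> S \<and> x3 \<in> S \<and> x4 \<in> S \<and>
     x1 \<oplus>\<^bsub>ZN N\<^esub> x2 = x3 \<oplus>\<^bsub>ZN N\<^esub> x4}"
  have "finite S" using assms finite_subset by blast
  have cancel: "y = y'" if "y \<in> S" "y' \<in> S" "(x + y) mod int N = (x + y') mod int N" for x y y'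
  proof -
    have "y mod int N = y' mod int N"
      using that(3) by (metis add_diff_cancel_left' mod_diff_left_eq)
    moreover have "y mod int N = y" "y' mod int N = y'"
      using that(1,2) assms by (auto intro!: mod_pos_pos_trivial)
    ultimately show ?thesis by simp
  qed
  have "inj_on (\<lambda>(x1, x2, x3, x4). (x1, x2, x3)) ?Q"
    by (rule inj_onI) (auto simp: add_ZN dest: cancel)
  then have "card ?Q \<le> card (S \<times> S \<times> S)"
    using \<open>finite S\<close> by (intro card_inj_on_le) auto
  then show ?thesis
    by (simp add: energy_def card_cartesian_product power3_eq_cube mult.assoc)
qed

text \<open>Cauchy--Schwarz for the representation counts over the sumset: they add up to
  \<open>card S ^ 2\<close>, and their squares add up to the energy. Small doubling thus forces
  large energy.\<close>

lemma card_power4_le_sumset_energy: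
  assumes "finite S"
  shows "card S ^ 4 \<le> card (sumset N S) * energy N S"
proof -
  define R where "R z = {(x, y). x \<in> S \<and> y \<in> S \<and> x \<oplus>\<^bsub>ZN N\<^esub> y = z}" for z
  have fin_R: "finite (R z)" for z
    by (rule finite_subset[of _ "S \<times> S"]) (auto simp: R_def assms)
  have "S \<times> S = (\<Union>z\<in>sumset N S. R z)"
    by (auto simp: R_def sumset_def)
  also have "card \<dots> = (\<Sum>z\<in>sumset N S. card (R z))"
    by (rule card_UN_disjoint) (auto simp: finite_sumset assms fin_R, auto simp: R_def)
  finally have card_SS: "card S * card S = (\<Sum>z\<in>sumset N S. card (R z))"
    by (simp add: card_cartesian_product)
  \<comment> \<open>An additive quadruple is a pair of representations of the same
    \<open>z\<close>.\<close>
  have "energy N S = card (\<Union>z\<in>sumset N S. R z \<times> R z)"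
    unfolding energy_def
    by (rule bij_betw_same_card[of "\<lambda>(x1, x2, x3, x4). ((x1, x2), (x3, x4))"],
        rule bij_betw_byWitness[where f' = "\<lambda>((x1, x2), (x3, x4)). (x1, x2, x3, x4)"])
      (auto simp: R_def sumset_def)
  also have "\<dots> = (\<Sum>z\<in>sumset N S. card (R z \<times> R z))"
    by (rule card_UN_disjoint) (auto simp: finite_sumset assms fin_R, auto simp: R_def)
  finally have energy: "energy N S = (\<Sum>z\<in>sumset N S. (card (R z))\<^sup>2)"
    by (simp add: card_cartesian_product power2_eq_square)
  have "(\<Sum>z\<in>sumset N S. real (card (R z)))\<^sup>2
      \<le> (\<Sum>z\<in>sumset N S. (real (card (R z)))\<^sup>2) * real (card (sumset N S))"
    by (rule sum_squared_le_sum_of_squares)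
  then have "real ((card S * card S)\<^sup>2) \<le> real (energy N S * card (sumset N S))"
    unfolding card_SS energy by simp
  then have "(card S * card S)\<^sup>2 \<le> energy N S * card (sumset N S)"
    by (simp only: of_nat_le_iff)
  then show ?thesis
    by (simp add: power2_eq_square power4_eq_xxxx mult_ac)
qed

section \<open>Comparability and the exponent \<open>kappa\<close>\<close>

lemma comparableI:
  assumes "0 < c" "0 < C"
    and "\<And>N. N \<ge> 2 \<Longrightarrow> c * B N \<le> A N" "\<And>N. N \<ge> 2 \<Longrightarrow> A N \<le> C * B N"
  shows "comparable A B"
  using assms unfolding comparable_def by blast

text \<open>The numerator of \<open>kappa_at\<close> is minus the logarithm of
  \<open>FR / sqrt N\<close>, which stays between two constants, while the denominator
  \<open>ln N\<close> tends to infinity.\<close>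

lemma kappa_eq_0:
  assumes "c > 0"
    and lower: "\<And>N. N \<ge> 2 \<Longrightarrow> c * sqrt (real N) \<le> FR N (f N)"
    and upper: "\<And>N. N \<ge> 2 \<Longrightarrow> FR N (f N) \<le> C * sqrt (real N)"
  shows "kappa f = 0"
proof -
  have "C > 0"
  proof -
    have "0 < c * sqrt 2" using \<open>c > 0\<close> by simp
    also have "\<dots> \<le> C * sqrt 2"
      using order_trans[OF lower[of 2] upper[of 2]] by (simp only: of_nat_numeral)
    finally show ?thesis by (simp add: zero_less_mult_iff)
  qed
  have "(\<lambda>N. kappa_at N (f N)) \<longlonglongrightarrow> 0"
  proof (rule tendsto_sandwich)
    have bounds: "- ln C / ln (real N) \<le> kappa_at N (f N) \<and> kappa_at N (f N) \<le> - ln c / ln (real N)"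
      if "N \<ge> 2" for N
    proof -
      define q where "q = FR N (f N) / sqrt (real N)"
      have q: "c \<le> q" "q \<le> C"
        using lower[OF that] upper[OF that] that by (simp_all add: q_def field_simps)
      have "real N powr (1/2) / FR N (f N) = inverse q"
        by (simp add: q_def powr_half_sqrt)
      then have "kappa_at N (f N) = - ln q / ln (real N)"
        using q \<open>c > 0\<close> by (simp add: kappa_at_def ln_inverse)
      moreover have "ln c \<le> ln q" "ln q \<le> ln C"
        using q \<open>c > 0\<close> by simp_all
      ultimately show ?thesis
        using that by (auto intro!: divide_right_mono)
    qed
    show "\<forall>\<^sub>F N in sequentially. - ln C / ln (real N) \<le> kappa_at N (f N)"
      "\<forall>\<^sub>F N in sequentially. kappa_at N (f N) \<le> - ln c / ln (real N)"
      using eventually_ge_at_top[of 2] by (eventually_elim, use bounds in blast)+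
    have "filterlim (\<lambda>N. ln (real N)) at_top sequentially"
      by (intro filterlim_compose[OF ln_at_top] filterlim_real_sequentially)
    from real_tendsto_divide_at_top[OF tendsto_const this]
    show "(\<lambda>N. - ln C / ln (real N)) \<longlonglongrightarrow> 0" "(\<lambda>N. - ln c / ln (real N)) \<longlonglongrightarrow> 0"
      by this+
  qed
  then have "(\<lambda>N. ereal (kappa_at N (f N))) \<longlonglongrightarrow> ereal 0"
    by simp
  then show ?thesis
    unfolding kappa_def by (subst lim_imp_Liminf) (auto simp: zero_ereal_def)
qed

lemma power_of_2_sandwich:
  fixes y :: real
  assumes "1 \<le> y"
  obtains k where "2 ^ k \<le> y" "y < 2 * 2 ^ k"
proof -
  have "1 \<le> nat \<lfloor>y\<rfloor>" using assms by (simp add: le_nat_iff le_floor_iff)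
  from ex_power_ivl1[OF _ this, of 2] obtain k
    where "2 ^ k \<le> nat \<lfloor>y\<rfloor>" "nat \<lfloor>y\<rfloor> < 2 ^ (k + 1)" by auto
  then have "2 ^ k \<le> \<lfloor>y\<rfloor>" "\<lfloor>y\<rfloor> < 2 * 2 ^ k"
    using assms by (simp_all add: le_nat_iff nat_less_iff)
  then have "2 ^ k \<le> y" "y < 2 * 2 ^ k"
    by (simp_all add: le_floor_iff floor_less_iff)
  then show ?thesis by (rule that)
qed

section \<open>Choice of the scale and assembly\<close>

theorem proposition8p5:
  fixes \<alpha> :: real
  assumes "0 < \<alpha>" and "\<alpha> < 1"
  shows "\<exists>S :: nat \<Rightarrow> int set.
      (\<forall>N\<ge>2. S N \<subseteq> carrier (ZN N)) \<and>
      comparable (\<lambda>N. real (card (S N))) (\<lambda>N. real N powr \<alpha>) \<and>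
      (\<forall>N\<ge>2. card (sumset N (S N)) \<le> 6 * card (S N)) \<and>
      comparable (\<lambda>N. FR N (indicator (S N))) (\<lambda>N. real N powr (1/2)) \<and>
      comparable (\<lambda>N. real (energy N (S N))) (\<lambda>N. real (card (S N)) ^ 3) \<and>
      kappa (\<lambda>N. indicator (S N)) = 0"
proof -
  have "\<exists>k. 2 ^ k \<le> real N powr \<alpha> \<and> real N powr \<alpha> < 2 * 2 ^ k" if "N \<ge> 2" for N
  proof -
    have "1 \<le> real N powr \<alpha>" using that assms by (intro ge_one_powr_ge_zero) auto
    then show ?thesis using power_of_2_sandwich by blast
  qed
  then obtain k where k: "2 ^ k N \<le> real N powr \<alpha>" "real N powr \<alpha> < 2 * 2 ^ k N" if "N \<ge> 2" for N
    by metis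
  \<comment> \<open>The interval length is the power of two within a factor 2 below
    \<open>N powr \<alpha>\<close>.\<close>
  define S where "S N = rs_set (k N)" for N
  have kN: "2 ^ k N \<le> N" if "N \<ge> 2" for N
  proof -
    have "real (2 ^ k N) \<le> real N powr \<alpha>" using k(1)[OF that] by simp
    also have "\<dots> \<le> real N" using powr_mono[of \<alpha> 1 "real N"] assms that by simp
    finally have "real (2 ^ k N) \<le> real N" .
    then show ?thesis by (simp only: of_nat_le_iff)
  qed
  have finite_S: "finite (S N)" for N
    using finite_subset[OF rs_set_subset] by (simp add: S_def)
  have sub: "S N \<subseteq> {0..<int N}" if "N \<ge> 2" for N
  proof -
    have "int (2 ^ k N) \<le> int N" using kN[OF that] by (simp only: of_nat_le_iff)
    then have "{0..<2 ^ k N} \<subseteq> {0..<int N}" by auto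
    then show ?thesis using rs_set_subset unfolding S_def by blast
  qed
  \<comment> \<open>The sumset has at most \<open>2 * 2 ^ k N\<close> elements, and
    \<open>2 ^ k N\<close> is at most twice the size of the set.\<close>
  have sumset_le: "card (sumset N (S N)) \<le> 4 * card (S N)" for N
    using card_sumset_interval_le[of "S N" "2 ^ k N" N] rs_set_subset[of "k N"]
      card_rs_set_ge[of "k N"] by (simp add: S_def)
  have "comparable (\<lambda>N. real (card (S N))) (\<lambda>N. real N powr \<alpha>)"
  \<comment> \<open>One factor 2 is lost in rounding to a power of two, another in passing to the
    positive signs.\<close>
  proof (rule comparableI[of "1 / 4" 1])
    fix N :: nat assume N: "N \<ge> 2"
    have "real (2 ^ k N) \<le> real (2 * card (S N))" "real (card (S N)) \<le> real (2 ^ k N)"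
      unfolding S_def of_nat_le_iff by (rule card_rs_set_ge card_rs_set_le)+
    then show "1 / 4 * real N powr \<alpha> \<le> real (card (S N))" "real (card (S N)) \<le> 1 * real N powr \<alpha>"
      using k[OF N] by (simp_all del: of_nat_le_iff of_nat_le_numeral_power_cancel_iff)
  qed simp_all
  moreover have FR: "1 / 2 * sqrt (real N) \<le> FR N (indicator (S N))"
    "FR N (indicator (S N)) \<le> 1 * sqrt (real N)" if "N \<ge> 2" for N
    using FR_rs_set_ge[OF kN[OF that]] FR_le_sqrt by (simp_all add: S_def)
  then have "comparable (\<lambda>N. FR N (indicator (S N))) (\<lambda>N. real N powr (1/2))"
    by (intro comparableI[of "1 / 2" 1]) (simp_all add: powr_half_sqrt)
  moreover have "kappa (\<lambda>N. indicator (S N)) = 0"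
    by (rule kappa_eq_0[OF _ FR]) simp_all
  moreover have "comparable (\<lambda>N. real (energy N (S N))) (\<lambda>N. real (card (S N)) ^ 3)"
  proof (rule comparableI[of "1 / 4" 1])
    fix N :: nat assume N: "N \<ge> 2"
    \<comment> \<open>Doubling at most 4 enters here; cancelling one factor
      \<open>card (S N)\<close> gives the constant 1/4.\<close>
    have "card (S N) ^ 4 \<le> 4 * card (S N) * energy N (S N)"
      using card_power4_le_sumset_energy[OF finite_S] sumset_le
      by (meson mult_le_mono1 order_trans)
    then have "card (S N) * card (S N) ^ 3 \<le> card (S N) * (4 * energy N (S N))"
      by (simp add: power4_eq_xxxx power3_eq_cube mult_ac)
    moreover have "card (S N) > 0"
      using card_rs_set_ge[of "k N"]
        less_le_trans[of 0 "2 ^ k N" "2 * card (rs_set (k N))"] by (simp add: S_def)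
    ultimately have "card (S N) ^ 3 \<le> 4 * energy N (S N)"
      by simp
    then have "real (card (S N) ^ 3) \<le> real (4 * energy N (S N))"
      by (simp only: of_nat_le_iff)
    then show "1 / 4 * real (card (S N)) ^ 3 \<le> real (energy N (S N))"
      by simp
    have "real (energy N (S N)) \<le> real (card (S N) ^ 3)"
      unfolding of_nat_le_iff by (rule energy_le[OF sub[OF N]])
    then show "real (energy N (S N)) \<le> 1 * real (card (S N)) ^ 3"
      by simp
  qed simp_all
  moreover have "card (sumset N (S N)) \<le> 6 * card (S N)" for N
    using sumset_le[of N] by linarith
  ultimately show ?thesis
    using sub by (intro exI[of _ S]) (simp add: carrier_ZN)
qed

end
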